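(* Let $R$ be a commutative ring with identity and let $\mathrm{X}(R)$ be a spectrum of $R$. If $\mathrm{X}(R)$ contains the zero ideal of $R$, then the ideal space $\mathrm{X}(R)$ is connected.
   Context: A spectrum $\mathrm{X}(R)$ of $R$ is an arbitrary class (set) of ideals of $R$ with $R\notin \mathrm{X}(R)$. For an ideal $\mathfrak{a}$ of $R$ put $\mathrm{h}(\mathfrak{a})=\{\mathfrak{s}\in \mathrm{X}(R)\mid \mathfrak{a}\subseteq \mathfrak{s}\}$. The ideal space $\mathrm{X}(R)$ is the set $\mathrm{X}(R)$ with the topology having $\{\mathrm{h}(\mathfrak{a})\mid \mathfrak{a} \text{ an ideal of } R\}$ as a closed subbase. *)

theory Defs
  imports "HOL-Algebra.Ideal" "HOL-Analysis.Abstract_Topology"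
begin

definition spectrum_of :: "('a, 'b) ring_scheme \<Rightarrow> 'a set set \<Rightarrow> bool" where
  "spectrum_of R X \<longleftrightarrow> (\<forall>\<ss>\<in>X. ideal \<ss> R) \<and> carrier R \<notin> X"

definition ideal_hull :: "'a set set \<Rightarrow> 'a set \<Rightarrow> 'a set set" where
  "ideal_hull X \<aa> = {\<ss> \<in> X. \<aa> \<subseteq> \<ss>}"

(* The topology with the hulls as a closed subbase is generated by their complements as an
   open subbase. Here \<aa> ranges over all ideals, including the improper one, whose hull is empty;
   hence the generated topology really lives on all of X (see topspace_ideal_space). *)
definition ideal_space :: "('a, 'b) ring_scheme \<Rightarrow> 'a set set \<Rightarrow> 'a set topology" where
  "ideal_space R X = topology_generated_by {X - ideal_hull X \<aa> |\<aa>. ideal \<aa> R}"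

lemma topspace_ideal_space:
  assumes "ring R" and "spectrum_of R X"
  shows "topspace (ideal_space R X) = X"
proof -
  have "\<ss> \<noteq> carrier R \<and> \<ss> \<subseteq> carrier R" if "\<ss> \<in> X" for \<ss>
  proof -
    have "ideal \<ss> R" and "\<ss> \<noteq> carrier R"
      using assms(2) that by (auto simp only: spectrum_of_def)
    then show ?thesis
      by (simp add: additive_subgroup.a_subset ideal.axioms(1))
  qed
  then have "ideal_hull X (carrier R) = {}"
    unfolding ideal_hull_def by blast
  then have "X = X - ideal_hull X (carrier R)"
    by simp
  moreover have "ideal (carrier R) R"
    using assms(1) by (rule ring.oneideal)
  ultimately have "X \<in> {X - ideal_hull X \<aa> |\<aa>. ideal \<aa> R}"
    by (intro CollectI exI conjI)
  then show ?thesis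
    unfolding ideal_space_def topology_generated_by_topspace by blast
qed

lemma closedin_ideal_hull:
  assumes "ring R" and "spectrum_of R X" and "ideal \<aa> R"
  shows "closedin (ideal_space R X) (ideal_hull X \<aa>)"
proof -
  have "openin (ideal_space R X) (X - ideal_hull X \<aa>)"
    unfolding ideal_space_def using assms(3) by (intro topology_generated_by_Basis) blast
  moreover have "ideal_hull X \<aa> \<subseteq> X"
    by (auto simp: ideal_hull_def)
  ultimately show ?thesis
    by (simp add: closedin_def topspace_ideal_space[OF assms(1,2)])
qed

end

theory Submission
  imports Defs
begin

text \<open>
  The zero ideal is a generic point of the ideal space. It lies in the hull of an ideal
  only if that ideal is zero itself, and then the hull is all of \<open>X\<close>. So each subbasic open
  set is empty or contains the zero ideal, and this property passes to finite intersections
  and to arbitrary unions (\<open>generic_point_of_subbase\<close>). Any two nonempty open sets thus meet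
  in the zero ideal, and the space cannot be split into two disjoint ones.
\<close>

text \<open>
  Finite intersections cause no trouble because the point \<open>p\<close> is the same for all members of
  the subbase: if \<open>A \<inter> B\<close> is nonempty, so are \<open>A\<close> and \<open>B\<close>, and both contain \<open>p\<close>. Requiring
  only that nonempty subbasic sets meet pairwise would not suffice here.
\<close>

lemma generic_point_of_subbase:
  assumes "openin (topology_generated_by \<B>) U" and "U \<noteq> {}"
    and generic: "\<And>B. B \<in> \<B> \<Longrightarrow> B \<noteq> {} \<Longrightarrow> p \<in> B"
  shows "p \<in> U"
proof -
  have "generate_topology_on \<B> U"
    using assms(1) by (rule openin_topology_generated_by)
  then have "U \<noteq> {} \<longrightarrow> p \<in> U"
    by induction (use generic in blast)+
  with assms(2) show ?thesis
    by simp
qed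

lemma connected_space_if_generic_point:
  assumes "\<And>U. openin T U \<Longrightarrow> U \<noteq> {} \<Longrightarrow> p \<in> U"
  shows "connected_space T"
  unfolding connected_space_def using assms by blast

lemma zero_ideal_in_complement_of_hull:
  assumes "spectrum_of R X" and "{\<zero>\<^bsub>R\<^esub>} \<in> X" and "X - ideal_hull X \<aa> \<noteq> {}"
  shows "{\<zero>\<^bsub>R\<^esub>} \<in> X - ideal_hull X \<aa>"
proof -
  obtain \<ss> where "\<ss> \<in> X" and "\<not> \<aa> \<subseteq> \<ss>"
    using assms(3) by (auto simp: ideal_hull_def)
  moreover have "\<zero>\<^bsub>R\<^esub> \<in> \<ss>"
    using assms(1) \<open>\<ss> \<in> X\<close>
    by (simp add: spectrum_of_def additive_subgroup.zero_closed ideal.axioms(1))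
  ultimately have "\<not> \<aa> \<subseteq> {\<zero>\<^bsub>R\<^esub>}"
    by blast
  with assms(2) show ?thesis
    by (simp add: ideal_hull_def)
qed

theorem theorem3p27:
  fixes R :: "('a, 'b) ring_scheme" and X :: "'a set set"
  assumes "cring R"
    and "spectrum_of R X"
    and "{\<zero>\<^bsub>R\<^esub>} \<in> X"
  shows "connected_space (ideal_space R X)"
proof (rule connected_space_if_generic_point)
  fix U
  assume "openin (ideal_space R X) U" and "U \<noteq> {}"
  then show "{\<zero>\<^bsub>R\<^esub>} \<in> U"
    unfolding ideal_space_def
  proof (rule generic_point_of_subbase)
    fix B
    assume "B \<in> {X - ideal_hull X \<aa> |\<aa>. ideal \<aa> R}" and "B \<noteq> {}"
    then show "{\<zero>\<^bsub>R\<^esub>} \<in> B"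
      using zero_ideal_in_complement_of_hull[OF assms(2,3)] by blast
  qed
qed

end
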